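(* Assume that $x_1,\ldots,x_N$ form a polynomial ensemble on $I^N$, where $I\subseteq\mathbb{R}$ is an interval, i.e. they have joint probability density $$\mathcal{P}(x_1,\ldots,x_N)=\frac{1}{\mathcal{Z}_N}\,\Delta_N(x_1,\ldots,x_N)\,\det[\varphi_l(x_k)]_{k,l=1}^N .$$ Let $M\in\mathbb{N}$ and let $u_1,\ldots,u_M\in\mathbb{C}\setminus\mathbb{R}$ and $z_1,\ldots,z_M\in\mathbb{C}$ be pairwise distinct. Then $$\mathbb{E}\left[\prod_{m=1}^M\frac{D_N(z_m)}{D_N(u_m)}\right]=\left[\det\left(\frac{1}{u_i-z_j}\right)_{i,j=1}^M\right]^{-1}\det\left[\frac{1}{u_i-z_j}\,\mathbb{E}\left(\frac{D_N(z_j)}{D_N(u_i)}\right)\right]_{i,j=1}^M ,$$ where $D_N(z)=\prod_{n=1}^N(z-x_n)$ and $\mathbb{E}$ denotes expectation with respect to $\mathcal{P}$.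
   Context: Polynomial ensemble: $I\subseteq\mathbb{R}$ is an interval, $\varphi_1,\ldots,\varphi_N$ are integrable real-valued functions on $I$, $\Delta_N(x_1,\ldots,x_N)=\prod_{1\le i<j\le N}(x_i-x_j)$ is the Vandermonde determinant, and the normalisation constant $\mathcal{Z}_N=\int_{I^N}\Delta_N(x_1,\ldots,x_N)\det[\varphi_l(x_k)]_{k,l=1}^N\,dx_1\cdots dx_N$ exists and is non-zero. One has $\mathcal{Z}_N=N!\,(-1)^{N(N-1)/2}\det G$ with the (invertible) generalised moment matrix $G=(g_{k,l})_{k,l=1}^N$, $g_{k,l}=\int_I x^{k-1}\varphi_l(x)\,dx$. The function $\mathcal{P}$ is assumed to be a probability density on $I^N$. *)

theory Defs
  imports "HOL-Analysis.Analysis" "Jordan_Normal_Form.Determinant"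
begin

text \<open>
  Points of \<open>I^N\<close> are extensional functions on \<open>{..<N}\<close>, and all families are indexed from \<open>0\<close>.
  \<open>Determinant.det\<close> and \<open>Matrix.mat\<close> are those of Jordan\_Normal\_Form, whose sizes are natural numbers.
\<close>

definition lebesgue_pow :: "real set \<Rightarrow> nat \<Rightarrow> (nat \<Rightarrow> real) measure" where
  "lebesgue_pow I N = PiM {..<N} (\<lambda>_. lebesgue_on I)"

definition vandermonde_prod :: "nat \<Rightarrow> (nat \<Rightarrow> real) \<Rightarrow> real" where
  "vandermonde_prod N x = (\<Prod>j<N. \<Prod>i<j. x i - x j)"

definition ensemble_weight :: "nat \<Rightarrow> (nat \<Rightarrow> real \<Rightarrow> real) \<Rightarrow> (nat \<Rightarrow> real) \<Rightarrow> real" where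
  "ensemble_weight N \<phi> x =
     vandermonde_prod N x * Determinant.det (Matrix.mat N N (\<lambda>(k, l). \<phi> l (x k)))"

definition ensemble_norm :: "real set \<Rightarrow> nat \<Rightarrow> (nat \<Rightarrow> real \<Rightarrow> real) \<Rightarrow> real" where
  "ensemble_norm I N \<phi> = (\<integral>x. ensemble_weight N \<phi> x \<partial>lebesgue_pow I N)"

definition ensemble_density ::
    "real set \<Rightarrow> nat \<Rightarrow> (nat \<Rightarrow> real \<Rightarrow> real) \<Rightarrow> (nat \<Rightarrow> real) \<Rightarrow> real" where
  "ensemble_density I N \<phi> x = 1 / ensemble_norm I N \<phi> * ensemble_weight N \<phi> x"

text \<open>
  That the density has total mass \<open>1\<close> is the definition of the normalisation constant, so being a
  probability density only requires nonnegativity almost everywhere. The moments of the \<open>\<phi> l\<close>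
  are not assumed to exist, as this follows from integrability of the weight and
  \<open>ensemble_norm I N \<phi> \<noteq> 0\<close>.
\<close>

definition polynomial_ensemble :: "real set \<Rightarrow> nat \<Rightarrow> (nat \<Rightarrow> real \<Rightarrow> real) \<Rightarrow> bool" where
  "polynomial_ensemble I N \<phi> \<longleftrightarrow>
     is_interval I \<and>
     (\<forall>l<N. integrable (lebesgue_on I) (\<phi> l)) \<and>
     integrable (lebesgue_pow I N) (ensemble_weight N \<phi>) \<and>
     ensemble_norm I N \<phi> \<noteq> 0 \<and>
     (AE x in lebesgue_pow I N. 0 \<le> ensemble_density I N \<phi> x)"

definition ensemble_measure ::
    "real set \<Rightarrow> nat \<Rightarrow> (nat \<Rightarrow> real \<Rightarrow> real) \<Rightarrow> (nat \<Rightarrow> real) measure" where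
  "ensemble_measure I N \<phi> =
     density (lebesgue_pow I N) (\<lambda>x. ennreal (ensemble_density I N \<phi> x))"

definition ensemble_expectation ::
    "real set \<Rightarrow> nat \<Rightarrow> (nat \<Rightarrow> real \<Rightarrow> real) \<Rightarrow> ((nat \<Rightarrow> real) \<Rightarrow> complex) \<Rightarrow> complex" where
  "ensemble_expectation I N \<phi> f = (\<integral>x. f x \<partial>ensemble_measure I N \<phi>)"

definition D_poly :: "nat \<Rightarrow> complex \<Rightarrow> (nat \<Rightarrow> real) \<Rightarrow> complex" where
  "D_poly N w x = (\<Prod>n<N. w - of_real (x n))"

end

theory Submission
  imports Defs
begin

text \<open>
  Put \<open>f x = (\<Prod>m<M. (z m - x) / (u m - x))\<close>. By Andreief's identity the expectation of
  \<open>\<Prod>n<N. f (x n)\<close> is \<open>det G' / det G\<close>, where \<open>G\<close> is the moment matrix and \<open>G'\<close> has the entries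
  \<open>\<integral> x^k f(x) \<phi>\<^sub>l(x) dx\<close>. Partial fractions write \<open>x^k f(x)\<close> as a monic polynomial of degree \<open>k\<close> plus a
  combination of the functions \<open>1 / (u m - x)\<close>. Comparing integrals against the \<open>\<phi>\<^sub>l\<close> and values at the
  zeros \<open>z j\<close> of \<open>f\<close>, this is a unimodular row operation on the block matrix with rows \<open>(G, X)\<close> and
  \<open>(H, W)\<close>, where \<open>X = (z j ^ k)\<close>, \<open>H = (\<integral> \<phi>\<^sub>l(x) / (u i - x) dx)\<close> and \<open>W\<close> is the Cauchy matrix.
  Hence \<open>det G' * det W = det G * det (W - H * G\<^sup>-\<^sup>1 * X)\<close>. The \<open>(i, j)\<close> entry of the Schur complement
  depends only on \<open>u i\<close> and \<open>z j\<close>, so the case \<open>M = 1\<close> identifies it.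
\<close>

section \<open>Andreief's identity and a Tonelli argument\<close>

lemma det_mat_leibniz:
  "Determinant.det (Matrix.mat n n f) =
     (\<Sum>p | p permutes {0..<n}. signof p * (\<Prod>i<n. f (i, p i)))"
  by (subst det_def'[of _ n]) (auto intro!: sum.cong prod.cong simp: permutes_in_image atLeast0LessThan)

lemma det_mat_scale_rows:
  "Determinant.det (Matrix.mat n n (\<lambda>(k, l). c k * f k l)) =
     (\<Prod>k<n. c k) * Determinant.det (Matrix.mat n n (\<lambda>(k, l). f k l))"
  by (simp add: det_mat_leibniz prod.distrib sum_distrib_left mult_ac)

text \<open>Expanding both determinants over permutations \<open>p\<close> and \<open>q\<close>
  gives products of one-variable functions, which the product measure integrates factor by factor.
  For fixed \<open>p\<close> the sum over \<open>q\<close> is a determinant with rows permuted by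
  \<open>p\<close>; its sign cancels the outer one, so all \<open>fact n\<close> choices of
  \<open>p\<close> contribute equally.\<close>

lemma andreief_identity:
  fixes a b :: "nat \<Rightarrow> 'a \<Rightarrow> complex"
  assumes S: "sigma_finite_measure S"
    and int: "\<And>j l. j < n \<Longrightarrow> l < n \<Longrightarrow> integrable S (\<lambda>t. a j t * b l t)"
  shows "(\<integral>x. Determinant.det (Matrix.mat n n (\<lambda>(k, l). a l (x k))) *
                Determinant.det (Matrix.mat n n (\<lambda>(k, l). b l (x k))) \<partial>PiM {..<n} (\<lambda>_. S)) =
         fact n * Determinant.det (Matrix.mat n n (\<lambda>(j, l). \<integral>t. a j t * b l t \<partial>S))"
proof -
  interpret product_sigma_finite "\<lambda>_. S"
    using S by (intro product_sigma_finite.intro)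
  define P where "P = {p. p permutes {0..<n}}"
  have finP: "finite P" unfolding P_def by (simp add: finite_permutations)
  define g where "g = (\<lambda>j l. \<integral>t. a j t * b l t \<partial>S)"
  let ?G = "Matrix.mat n n (\<lambda>(j, l). g j l)"
  have lt: "p i < n" if "p \<in> P" "i < n" for p i
    using that permutes_in_image[of p "{0..<n}" i] by (auto simp: P_def)
  have int': "integrable (PiM {..<n} (\<lambda>_. S)) (\<lambda>x. \<Prod>i<n. a (p i) (x i) * b (q i) (x i))"
    if "p \<in> P" "q \<in> P" for p q
    by (intro product_integrable_prod finite_lessThan int lt[OF that(1)] lt[OF that(2)]) auto
  have int'': "integrable (PiM {..<n} (\<lambda>_. S))
      (\<lambda>x. (signof p * signof q) * (\<Prod>i<n. a (p i) (x i) * b (q i) (x i)))"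
    if "p \<in> P" "q \<in> P" for p q
    by (rule integrable_mult_right, rule int'[OF that])
  have expand: "Determinant.det (Matrix.mat n n (\<lambda>(k, l). a l (x k))) *
                Determinant.det (Matrix.mat n n (\<lambda>(k, l). b l (x k))) =
        (\<Sum>p\<in>P. \<Sum>q\<in>P. (signof p * signof q) *
            (\<Prod>i<n. a (p i) (x i) * b (q i) (x i)))" for x
    unfolding det_mat_leibniz P_def[symmetric] sum_product prod.distrib prod.case
    by (intro sum.cong refl) (simp only: mult_ac)
  have "(\<integral>x. Determinant.det (Matrix.mat n n (\<lambda>(k, l). a l (x k))) *
                Determinant.det (Matrix.mat n n (\<lambda>(k, l). b l (x k))) \<partial>PiM {..<n} (\<lambda>_. S)) =
        (\<Sum>p\<in>P. \<integral>x. (\<Sum>q\<in>P. (signof p * signof q) *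
            (\<Prod>i<n. a (p i) (x i) * b (q i) (x i))) \<partial>PiM {..<n} (\<lambda>_. S))"
    unfolding expand
    by (rule Bochner_Integration.integral_sum, rule Bochner_Integration.integrable_sum, rule int'')
  also have "\<dots> = (\<Sum>p\<in>P. \<Sum>q\<in>P. (\<integral>x. (signof p * signof q) *
            (\<Prod>i<n. a (p i) (x i) * b (q i) (x i)) \<partial>PiM {..<n} (\<lambda>_. S)))"
    by (intro sum.cong refl Bochner_Integration.integral_sum int'')
  also have "\<dots> = (\<Sum>p\<in>P. \<Sum>q\<in>P. (signof p * signof q) *
            (\<integral>x. (\<Prod>i<n. a (p i) (x i) * b (q i) (x i)) \<partial>PiM {..<n} (\<lambda>_. S)))"
    by simp
  also have "\<dots> = (\<Sum>p\<in>P. \<Sum>q\<in>P. (signof p * signof q) * (\<Prod>i<n. g (p i) (q i)))"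
  proof (intro sum.cong refl arg_cong[where f = "(*) _"])
    fix p q assume "p \<in> P" "q \<in> P"
    note pq = lt[OF this(1)] lt[OF this(2)]
    show "(\<integral>x. (\<Prod>i<n. a (p i) (x i) * b (q i) (x i)) \<partial>PiM {..<n} (\<lambda>_. S)) = (\<Prod>i<n. g (p i) (q i))"
      unfolding g_def by (intro product_integral_prod finite_lessThan int pq) auto
  qed
  also have "\<dots> = (\<Sum>p\<in>P. signof p * (\<Sum>q\<in>P. signof q * (\<Prod>i<n. g (p i) (q i))))"
    by (simp add: sum_distrib_left mult.assoc)
  also have "\<dots> = (\<Sum>p\<in>P. Determinant.det ?G)"
  proof (intro sum.cong refl)
    fix p assume p: "p \<in> P"
    have "(\<Sum>q\<in>P. signof q * (\<Prod>i<n. g (p i) (q i))) =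
      Determinant.det (Matrix.mat n n (\<lambda>(i, j). ?G $$ (p i, j)))"
      unfolding det_mat_leibniz P_def[symmetric] using lt p
      by (auto intro!: sum.cong prod.cong)
    also have "\<dots> = signof p * Determinant.det ?G"
      using p by (intro det_permute_rows) (auto simp: P_def)
    finally show "signof p * (\<Sum>q\<in>P. signof q * (\<Prod>i<n. g (p i) (q i))) = Determinant.det ?G"
      by (simp add: sign_def)
  qed
  also have "\<dots> = fact n * Determinant.det ?G"
    by (simp add: P_def card_permutations[of _ n])
  finally show ?thesis by (simp add: g_def)
qed

text \<open>Tonelli gives finiteness for almost every choice of the coordinates other than
  \<open>i\<close>. The exceptional set \<open>B\<close> of the full product does not depend on
  coordinate \<open>i\<close>, so almost all its sections in that direction are empty and it is
  null.\<close>

lemma (in product_sigma_finite) AE_nn_integral_fun_upd_finite: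
  assumes J: "finite J" "i \<in> J"
    and f [measurable]: "f \<in> borel_measurable (PiM J M)"
    and fin: "integral\<^sup>N (PiM J M) f < \<infinity>"
  shows "AE x in PiM J M. (\<integral>\<^sup>+ y. f (x(i := y)) \<partial>M i) \<noteq> \<infinity>"
proof -
  define K where "K = J - {i}"
  have K: "finite K" "i \<notin> K" and J_eq: "J = insert i K"
    using J by (auto simp: K_def)
  interpret Mi: sigma_finite_measure "M i" by (rule sigma_finite_measures)
  have [measurable]: "(\<lambda>(x, y). x(i := y)) \<in> measurable (PiM K M \<Otimes>\<^sub>M M i) (PiM J M)"
    unfolding J_eq by (rule measurable_add_dim)
  have upd [measurable]: "(\<lambda>(x, y). x(i := y)) \<in> measurable (PiM J M \<Otimes>\<^sub>M M i) (PiM J M)"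
    using measurable_add_dim[of i J M] J(2) by (simp add: insert_absorb)
  have [measurable]: "(\<lambda>x. \<integral>\<^sup>+ y. f (x(i := y)) \<partial>M i) \<in> borel_measurable (PiM J M)"
    by measurable
  define B where "B = {x \<in> space (PiM J M). (\<integral>\<^sup>+ y. f (x(i := y)) \<partial>M i) = \<infinity>}"
  have B [measurable]: "B \<in> sets (PiM J M)"
    unfolding B_def by measurable
  have "(\<integral>\<^sup>+ x. (\<integral>\<^sup>+ y. f (x(i := y)) \<partial>M i) \<partial>PiM K M) < \<infinity>"
    using fin product_nn_integral_insert[OF K f[unfolded J_eq]] by (simp add: J_eq)
  moreover have "(\<lambda>x. \<integral>\<^sup>+ y. f (x(i := y)) \<partial>M i) \<in> borel_measurable (PiM K M)"
    by measurable
  ultimately have *: "AE x in PiM K M. (\<integral>\<^sup>+ y. f (x(i := y)) \<partial>M i) \<noteq> \<infinity>"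
    by (intro nn_integral_PInf_AE) auto
  have "emeasure (PiM J M) B = (\<integral>\<^sup>+ x. (\<integral>\<^sup>+ y. indicator B (x(i := y)) \<partial>M i) \<partial>PiM K M)"
    using product_nn_integral_insert[OF K, of "indicator B"] B by (simp add: J_eq)
  also have "\<dots> = (\<integral>\<^sup>+ x. 0 \<partial>PiM K M)"
  proof (rule nn_integral_cong_AE, use * in eventually_elim)
    case (elim x)
    \<comment> \<open>A first update at \<open>i\<close> is overwritten by the second, so the inner
      integral is the same at \<open>x\<close> and at \<open>x(i := y)\<close>.\<close>
    then have "indicator B (x(i := y)) = (0 :: ennreal)" for y
      by (auto simp: B_def indicator_def)
    then show ?case by simp
  qed
  finally have "B \<in> null_sets (PiM J M)" using B by auto
  then show ?thesis
    by (rule AE_I') (auto simp: B_def)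
qed

section \<open>Partial fractions and determinants\<close>

text \<open>Division by \<open>q\<close> splits off the polynomial part, and the remainder is
  recovered by Lagrange interpolation at the \<open>M\<close> points \<open>u m\<close>.\<close>

lemma partial_fractions:
  fixes p :: "complex poly" and u :: "nat \<Rightarrow> complex"
  assumes inj: "inj_on u {..<M}"
  defines "q \<equiv> (\<Prod>m<M. [:u m, -1:])"
  obtains c where "\<And>x. (\<And>m. m < M \<Longrightarrow> x \<noteq> u m) \<Longrightarrow>
    poly p x / (\<Prod>m<M. u m - x) = poly (p div q) x + (\<Sum>m<M. c m / (u m - x))"
proof -
  define r where "r = p mod q"
  have q0: "q \<noteq> 0" unfolding q_def by (subst prod_zero_iff) auto
  have degq: "degree q = M"
    unfolding q_def by (subst degree_prod_eq_sum_degree) auto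
  \<comment> \<open>\<open>e m\<close> is \<open>q\<close> without its \<open>m\<close>-th factor
    and \<open>d m\<close> is the value of \<open>e m\<close> at \<open>u m\<close>, so the
    \<open>c m\<close> are the Lagrange coefficients of \<open>r\<close>.\<close>
  define e where "e = (\<lambda>m. \<Prod>j\<in>{..<M}-{m}. [:u j, -1:])"
  define d where "d = (\<lambda>m. \<Prod>j\<in>{..<M}-{m}. u j - u m)"
  define c where "c = (\<lambda>m. poly r (u m) / d m)"
  have d0: "d m \<noteq> 0" if "m < M" for m
    using that inj by (auto simp: d_def inj_on_def)
  have r_eq: "r = (\<Sum>m<M. Polynomial.smult (c m) (e m))"
  \<comment> \<open>Interpolation needs a degree strictly below the number of nodes, which fails for
    \<open>M = 0\<close>; there the divisor is \<open>1\<close> and the remainder vanishes.\<close>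
  proof (cases "M = 0")
    case True
    then show ?thesis by (simp add: r_def q_def)
  next
    case False
    have dege: "degree (e m) = M - 1" if "m < M" for m
      unfolding e_def using that by (subst degree_prod_eq_sum_degree) auto
    show ?thesis
    proof (rule poly_eqI_degree[where A = "u ` {..<M}"])
      fix x assume "x \<in> u ` {..<M}"
      then obtain i where i: "i < M" "x = u i" by auto
      have "poly (e m) (u i) = (if m = i then d i else 0)" if "m < M" for m
      proof (cases "m = i")
        case True
        then show ?thesis by (simp add: e_def d_def poly_prod)
      next
        case False
        then show ?thesis using i by (auto simp: e_def poly_prod intro!: prod_zero bexI[of _ i])
      qed
      then have "poly (\<Sum>m<M. Polynomial.smult (c m) (e m)) (u i) = (\<Sum>m<M. if m = i then c i * d i else 0)"
        unfolding poly_sum poly_smult by (intro sum.cong) auto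
      also have "\<dots> = poly r (u i)" using i d0 by (simp add: c_def)
      finally show "poly r x = poly (\<Sum>m<M. Polynomial.smult (c m) (e m)) x" using i by simp
    next
      have card: "card (u ` {..<M}) = M" using inj by (simp add: card_image)
      show "degree r < card (u ` {..<M})"
        unfolding card r_def using degree_mod_less[OF q0, of p] degq False by auto
      have "degree (\<Sum>m<M. Polynomial.smult (c m) (e m)) \<le> M - 1"
        by (intro degree_sum_le) (auto intro!: order.trans[OF degree_smult_le] simp: dege)
      then show "degree (\<Sum>m<M. Polynomial.smult (c m) (e m)) < card (u ` {..<M})"
        unfolding card using False by linarith
    qed
  qed
  have "poly p x / (\<Prod>m<M. u m - x) = poly (p div q) x + (\<Sum>m<M. c m / (u m - x))"
    if x: "\<And>m. m < M \<Longrightarrow> x \<noteq> u m" for x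
  proof -
    have nz: "(\<Prod>m<M. u m - x) \<noteq> 0" using x by auto
    have qx: "poly q x = (\<Prod>m<M. u m - x)" by (simp add: q_def poly_prod)
    have "poly (e m) x / (\<Prod>m<M. u m - x) = 1 / (u m - x)" if "m < M" for m
    proof -
      have eq: "(\<Prod>m<M. u m - x) = (u m - x) * poly (e m) x"
        using that by (subst prod.remove[of _ m]) (auto simp: e_def poly_prod)
      then have "u m - x \<noteq> 0" "poly (e m) x \<noteq> 0" using nz by auto
      then show ?thesis unfolding eq by simp
    qed
    then have r: "poly r x / (\<Prod>m<M. u m - x) = (\<Sum>m<M. c m / (u m - x))"
      unfolding r_eq poly_sum sum_divide_distrib 
      by (intro sum.cong refl) (metis lessThan_iff mult.right_neutral poly_smult times_divide_eq_right)
    have "poly p x = poly (p div q) x * poly q x + poly r x"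
      unfolding r_def by (metis div_mult_mod_eq poly_add poly_mult)
    then have "poly p x / (\<Prod>m<M. u m - x) = poly (p div q) x + poly r x / (\<Prod>m<M. u m - x)"
      using nz by (simp add: qx add_divide_distrib)
    then show ?thesis by (simp only: r)
  qed
  then show thesis by (rule that)
qed

text \<open>
  A left inverse is read off from the partial fractions of the functions
  \<open>(\<Prod>m\<noteq>k. (z m - x)) / (\<Prod>m. (u m - x))\<close>, which vanish at all \<open>z j\<close> with \<open>j \<noteq> k\<close>.
\<close>

lemma cauchy_matrix_det_nonzero:
  fixes u z :: "nat \<Rightarrow> complex"
  assumes u: "inj_on u {..<M}" and z: "inj_on z {..<M}"
    and uz: "\<And>i j. i < M \<Longrightarrow> j < M \<Longrightarrow> u i \<noteq> z j"
  shows "Determinant.det (Matrix.mat M M (\<lambda>(i, j). 1 / (u i - z j))) \<noteq> 0"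
proof -
  define p where "p = (\<lambda>k. \<Prod>m\<in>{..<M}-{k}. [:z m, -1:])"
  have "\<exists>b. \<forall>j<M. (\<Sum>m<M. b m / (u m - z j)) = (if k = j then 1 else 0)" if k: "k < M" for k
  proof -
    obtain c where c: "\<And>x. (\<And>m. m < M \<Longrightarrow> x \<noteq> u m) \<Longrightarrow>
      poly (p k) x / (\<Prod>m<M. u m - x) =
      poly (p k div (\<Prod>m<M. [:u m, -1:])) x + (\<Sum>m<M. c m / (u m - x))"
      using partial_fractions[OF u, where p = "p k"] by blast
    \<comment> \<open>The numerator lacks one factor, so the fraction is proper and has no
      polynomial part.\<close>
    have "degree (p k) < M"
      unfolding p_def using k by (subst degree_prod_eq_sum_degree) auto
    moreover have "degree (\<Prod>m<M. [:u m, -1:]) = M"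
      by (subst degree_prod_eq_sum_degree) auto
    ultimately have div0: "p k div (\<Prod>m<M. [:u m, -1:]) = 0"
      by (intro div_poly_less) simp
    have c: "poly (p k) (z j) / (\<Prod>m<M. u m - z j) = (\<Sum>m<M. c m / (u m - z j))"
      if "j < M" for j
      using c[of "z j"] uz[OF _ that] unfolding div0 by fastforce
    define s where "s = poly (p k) (z k) / (\<Prod>m<M. u m - z k)"
    have s: "s \<noteq> 0"
      using z uz k by (auto simp: s_def p_def poly_prod inj_on_def)
    have z0: "poly (p k) (z j) = 0" if "j < M" "j \<noteq> k" for j
      using that by (auto simp: p_def poly_prod intro!: bexI[of _ j])
    have "(\<Sum>m<M. c m / s / (u m - z j)) = (if k = j then 1 else 0)" if j: "j < M" for j
    proof -
      have "(\<Sum>m<M. c m / s / (u m - z j)) = (\<Sum>m<M. c m / (u m - z j)) / s"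
        unfolding sum_divide_distrib by (intro sum.cong) (simp_all add: mult.commute)
      also have "\<dots> = poly (p k) (z j) / (\<Prod>m<M. u m - z j) / s"
        by (simp only: c[OF j])
      also have "\<dots> = (if k = j then 1 else 0)"
        using z0[OF j] s by (cases "k = j") (simp_all add: s_def)
      finally show ?thesis .
    qed
    then show ?thesis by (intro exI[of _ "\<lambda>m. c m / s"]) simp
  qed
  then obtain b where b: "\<And>k j. k < M \<Longrightarrow> j < M \<Longrightarrow>
      (\<Sum>m<M. b k m / (u m - z j)) = (if k = j then 1 else 0)" by metis
  have "Matrix.mat M M (\<lambda>(k, m). b k m) * Matrix.mat M M (\<lambda>(i, j). 1 / (u i - z j)) = 1\<^sub>m M"
    by (rule eq_matI) (auto simp: scalar_prod_def b atLeast0LessThan)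
  then show ?thesis
    using det_mult[of "Matrix.mat M M (\<lambda>(k, m). b k m)" M "Matrix.mat M M (\<lambda>(i, j). 1 / (u i - z j))"]
    by auto
qed

text \<open>
  Both sides are the determinant of the block matrix with rows \<open>(G, X)\<close> and \<open>(H, W)\<close>: on the left after
  clearing \<open>X\<close> with the rows of \<open>W\<close>, on the right by the Schur complement of \<open>G\<close>.
\<close>

lemma det_schur_exchange:
  fixes G T X C H W Gf :: "complex mat"
  assumes carr: "G \<in> carrier_mat n n" "T \<in> carrier_mat n n" "X \<in> carrier_mat n m"
      "C \<in> carrier_mat n m" "H \<in> carrier_mat m n" "W \<in> carrier_mat m m"
    and Gi: "Gi \<in> carrier_mat n n" "G * Gi = 1\<^sub>m n"
    and TX: "T * X + C * W = 0\<^sub>m n m"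
    and detT: "Determinant.det T = 1"
  shows "Determinant.det (T * G + C * H) * Determinant.det W =
    Determinant.det G * Determinant.det (W - H * (Gi * X))"
proof -
  let ?B = "four_block_mat G X H W"
  have "four_block_mat T C (0\<^sub>m m n) (1\<^sub>m m) * ?B = four_block_mat (T * G + C * H) (0\<^sub>m n m) H W"
    using carr by (subst mult_four_block_mat[of _ n n _ m _ m _ _ n _ m]) (auto simp: TX)
  moreover have "Determinant.det (four_block_mat T C (0\<^sub>m m n) (1\<^sub>m m)) = 1"
    using carr by (subst det_four_block_mat_lower_left_zero[of _ n _ m]) (auto simp: detT)
  moreover have "Determinant.det (four_block_mat (T * G + C * H) (0\<^sub>m n m) H W) =
      Determinant.det (T * G + C * H) * Determinant.det W"
    using carr by (intro det_four_block_mat_upper_right_zero[of _ n _ m]) auto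
  moreover have "Determinant.det (four_block_mat T C (0\<^sub>m m n) (1\<^sub>m m) * ?B) =
      Determinant.det (four_block_mat T C (0\<^sub>m m n) (1\<^sub>m m)) * Determinant.det ?B"
    using carr by (intro det_mult[of _ "n + m"]) auto
  ultimately have 1: "Determinant.det (T * G + C * H) * Determinant.det W = Determinant.det ?B"
    by simp
  have *: "G * (Gi * X) = X"
    using carr Gi by (metis assoc_mult_mat left_mult_one_mat)
  have HX: "H * (Gi * X) \<in> carrier_mat m m" using carr Gi by auto
  have WY: "H * (Gi * X) + (W - H * (Gi * X)) = W"
    using carr HX by (intro eq_matI) auto
  have "four_block_mat G (0\<^sub>m n m) H (1\<^sub>m m) *
        four_block_mat (1\<^sub>m n) (Gi * X) (0\<^sub>m m n) (W - H * (Gi * X)) = ?B"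
    using carr Gi HX
    by (subst mult_four_block_mat[of _ n n _ m _ m _ _ n _ m]) (auto simp: * WY)
  moreover have "Determinant.det (four_block_mat G (0\<^sub>m n m) H (1\<^sub>m m)) = Determinant.det G"
    using carr by (subst det_four_block_mat_upper_right_zero[of _ n _ m]) auto
  moreover have "Determinant.det (four_block_mat (1\<^sub>m n) (Gi * X) (0\<^sub>m m n) (W - H * (Gi * X))) =
      Determinant.det (W - H * (Gi * X))"
    using carr Gi HX by (subst det_four_block_mat_lower_left_zero[of _ n _ m]) auto
  moreover have "Determinant.det (four_block_mat G (0\<^sub>m n m) H (1\<^sub>m m) *
        four_block_mat (1\<^sub>m n) (Gi * X) (0\<^sub>m m n) (W - H * (Gi * X))) =
        Determinant.det (four_block_mat G (0\<^sub>m n m) H (1\<^sub>m m)) *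
        Determinant.det (four_block_mat (1\<^sub>m n) (Gi * X) (0\<^sub>m m n) (W - H * (Gi * X)))"
    using carr Gi HX by (intro det_mult[of _ "n + m"]) auto
  ultimately show ?thesis using 1 by simp
qed

section \<open>Moments of a polynomial ensemble\<close>

text \<open>
  The left-hand side is the determinant in the Newton basis \<open>\<Prod>i<j. (x i - t)\<close>, whose evaluation
  matrix at the points \<open>x k\<close> is lower triangular.
\<close>

lemma vandermonde_prod_eq_det:
  "complex_of_real (vandermonde_prod N x) * (\<Prod>j<N. (-1) ^ j) =
     Determinant.det (Matrix.mat N N (\<lambda>(k, l). complex_of_real (x k) ^ l))"
proof -
  define p where "p = (\<lambda>j. \<Prod>i<j. [:complex_of_real (x i), -1:])"
  have degp: "degree (p j) = j" for j
    unfolding p_def by (subst degree_prod_eq_sum_degree) auto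
  have lead: "poly.coeff (p j) j = (-1) ^ j" for j
  proof -
    have "lead_coeff (p j) = (-1) ^ j"
      unfolding p_def lead_coeff_prod by simp
    then show ?thesis by (simp only: degp)
  qed
  let ?V = "Matrix.mat N N (\<lambda>(k, l). complex_of_real (x k) ^ l)"
  let ?R = "Matrix.mat N N (\<lambda>(l, j). poly.coeff (p j) l)"
  let ?A = "Matrix.mat N N (\<lambda>(k, j). poly (p j) (complex_of_real (x k)))"
  have "?A = ?V * ?R"
  proof (rule eq_matI)
    fix k j assume "k < dim_row (?V * ?R)" "j < dim_col (?V * ?R)"
    then have kj: "k < N" "j < N" by auto
    have "poly (p j) (complex_of_real (x k)) = (\<Sum>l\<le>j. poly.coeff (p j) l * complex_of_real (x k) ^ l)"
      by (simp add: poly_altdef degp)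
    also have "\<dots> = (\<Sum>l<N. poly.coeff (p j) l * complex_of_real (x k) ^ l)"
      using kj by (intro sum.mono_neutral_left) (auto intro!: coeff_eq_0 simp: degp)
    finally show "?A $$ (k, j) = (?V * ?R) $$ (k, j)"
      using kj by (simp add: scalar_prod_def mult.commute atLeast0LessThan)
  qed auto
  then have "Determinant.det ?A = Determinant.det ?V * Determinant.det ?R"
    using det_mult[of ?V N ?R] by simp
  moreover have "Determinant.det ?A = complex_of_real (vandermonde_prod N x)"
  proof -
    have "Determinant.det ?A = prod_list (diag_mat ?A)"
      by (rule det_lower_triangular[of N]) (auto simp: p_def poly_prod)
    also have "\<dots> = (\<Prod>j<N. poly (p j) (complex_of_real (x j)))"
      by (simp add: prod_list_diag_prod atLeast0LessThan)
    also have "\<dots> = complex_of_real (vandermonde_prod N x)"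
      by (simp add: p_def poly_prod vandermonde_prod_def)
    finally show ?thesis .
  qed
  \<comment> \<open>As \<open>p j\<close> has degree \<open>j\<close>, the coefficient matrix is
    upper triangular; the leading coefficients on its diagonal produce the sign.\<close>
  moreover have "Determinant.det ?R = (\<Prod>j<N. (-1) ^ j)"
  proof -
    have "Determinant.det ?R = prod_list (diag_mat ?R)"
      by (rule det_upper_triangular[of _ N]) (auto intro!: upper_triangularI coeff_eq_0 simp: degp)
    also have "\<dots> = (\<Prod>j<N. (-1) ^ j)"
      by (simp add: prod_list_diag_prod atLeast0LessThan lead)
    finally show ?thesis .
  qed
  ultimately show ?thesis
    by (simp flip: power_mult_distrib prod.distrib)
qed

text \<open>
  Stated in absolute value because the sign of the constant depends on the position of \<open>i\<close>.
\<close>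

lemma abs_vandermonde_prod_fun_upd:
  assumes i: "i < N"
  obtains K where "\<And>t. \<bar>vandermonde_prod N (x(i := t))\<bar> = K * \<bar>\<Prod>j\<in>{..<N}-{i}. t - x j\<bar>"
proof -
  \<comment> \<open>\<open>P\<close> indexes the factors of the Vandermonde product,
    \<open>Q\<close> those that involve coordinate \<open>i\<close>; the product \<open>K\<close> of
    the others is independent of \<open>t\<close>.\<close>
  define P where "P = Sigma {..<N} (\<lambda>j. {..<j})"
  define Q where "Q = {(j, a). (j, a) \<in> P \<and> (j = i \<or> a = i)}"
  define K where "K = (\<Prod>(j, a)\<in>P - Q. \<bar>x a - x j\<bar>)"
  have "\<bar>vandermonde_prod N (x(i := t))\<bar> = K * \<bar>\<Prod>j\<in>{..<N}-{i}. t - x j\<bar>" for t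
  proof -
    let ?y = "x(i := t)"
    have QP: "Q \<subseteq> P" "finite P" by (auto simp: Q_def P_def)
    have "\<bar>vandermonde_prod N ?y\<bar> = (\<Prod>(j, a)\<in>P. \<bar>?y a - ?y j\<bar>)"
      unfolding vandermonde_prod_def P_def abs_prod by (subst prod.Sigma) auto
    also have "\<dots> = (\<Prod>(j, a)\<in>P - Q. \<bar>?y a - ?y j\<bar>) * (\<Prod>(j, a)\<in>Q. \<bar>?y a - ?y j\<bar>)"
      using QP by (intro prod.subset_diff) auto
    also have "(\<Prod>(j, a)\<in>P - Q. \<bar>?y a - ?y j\<bar>) = K"
      unfolding K_def by (intro prod.cong) (auto simp: Q_def split: if_splits)
    \<comment> \<open>A pair in \<open>Q\<close> is determined by its index \<open>m\<close> other
      than \<open>i\<close>; \<open>max\<close> and \<open>min\<close> restore the order that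
      \<open>P\<close> prescribes.\<close>
    also have "(\<Prod>(j, a)\<in>Q. \<bar>?y a - ?y j\<bar>) = (\<Prod>j\<in>{..<N}-{i}. \<bar>t - x j\<bar>)"
      by (intro prod.reindex_bij_witness[where i = "\<lambda>m. (max i m, min i m)" and
            j = "\<lambda>(j, a). if j = i then a else j"])
         (use i in \<open>auto simp: Q_def P_def max_def min_def abs_minus_commute split: if_splits\<close>)
    finally show ?thesis unfolding abs_prod .
  qed
  then show thesis by (rule that)
qed

text \<open>Once \<open>\<bar>t\<bar>\<close> exceeds twice every \<open>\<bar>r j\<bar>\<close>,
  each factor is at least \<open>\<bar>t\<bar> / 2\<close> in absolute value; on the remaining
  bounded range a constant suffices.\<close>

lemma power_abs_le_prod_diff:
  fixes r :: "'i \<Rightarrow> real"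
  assumes J: "finite J" and k: "k \<le> card J"
  obtains A B where "\<And>t. \<bar>t\<bar> ^ k \<le> A + B * \<bar>\<Prod>j\<in>J. t - r j\<bar>" "0 \<le> A" "0 \<le> B"
proof -
  define R where "R = (\<Sum>j\<in>J. \<bar>r j\<bar>)"
  have R: "\<bar>r j\<bar> \<le> R" if "j \<in> J" for j
    unfolding R_def using that J by (intro member_le_sum) auto
  have R0: "0 \<le> R" unfolding R_def by (intro sum_nonneg) auto
  \<comment> \<open>Beyond this threshold, \<open>2 * R\<close> dominates every root and the extra
    \<open>1\<close> gives \<open>\<bar>t\<bar> \<ge> 1\<close>, so the exponent \<open>k\<close>
    may be raised to \<open>card J\<close>.\<close>
  have "\<bar>t\<bar> ^ k \<le> (2 * R + 1) ^ k + 2 ^ card J * \<bar>\<Prod>j\<in>J. t - r j\<bar>" for t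
  proof (cases "\<bar>t\<bar> \<le> 2 * R + 1")
    case True
    then have "\<bar>t\<bar> ^ k \<le> (2 * R + 1) ^ k" by (intro power_mono) auto
    then show ?thesis by (intro add_increasing2) auto
  next
    case False
    have "\<bar>t\<bar> ^ k \<le> \<bar>t\<bar> ^ card J" using False R0 k by (intro power_increasing) auto
    also have "\<dots> = (\<Prod>j\<in>J. \<bar>t\<bar>)" by simp
    also have "\<dots> \<le> (\<Prod>j\<in>J. 2 * \<bar>t - r j\<bar>)"
    proof (intro prod_mono conjI)
      fix j assume "j \<in> J"
      then show "\<bar>t\<bar> \<le> 2 * \<bar>t - r j\<bar>" using R[of j] False abs_triangle_ineq2[of t "r j"] by simp
    qed auto
    also have "\<dots> = 2 ^ card J * \<bar>\<Prod>j\<in>J. t - r j\<bar>"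
      by (simp add: prod.distrib abs_prod)
    finally show ?thesis using R0 by (intro add_increasing) auto
  qed
  then show thesis by (rule that) (use R0 in auto)
qed

text \<open>By domination: \<open>\<psi>\<close> itself controls bounded \<open>t\<close>, its
  product with the \<open>t - r j\<close> controls large \<open>t\<close>. This turns integrability
  of the weight in one coordinate into existence of moments.\<close>

lemma integrable_power_mult:
  fixes \<psi> :: "real \<Rightarrow> real" and r :: "'i \<Rightarrow> real"
  assumes id: "(\<lambda>t. t) \<in> borel_measurable S"
    and \<psi>: "integrable S \<psi>" "integrable S (\<lambda>t. \<psi> t * (\<Prod>j\<in>J. t - r j))"
    and J: "finite J" and k: "k \<le> card J"
  shows "integrable S (\<lambda>t. t ^ k * \<psi> t)"
proof -
  obtain A B where AB: "\<And>t. \<bar>t\<bar> ^ k \<le> A + B * \<bar>\<Prod>j\<in>J. t - r j\<bar>" "0 \<le> A" "0 \<le> B"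
    using power_abs_le_prod_diff[OF J k, of r] by blast
  have [measurable]: "\<psi> \<in> borel_measurable S" using \<psi>(1) by simp
  note id [measurable]
  have "integrable S (\<lambda>t. A * \<bar>\<psi> t\<bar> + B * \<bar>\<psi> t * (\<Prod>j\<in>J. t - r j)\<bar>)"
    using \<psi> by auto
  then show ?thesis
  proof (rule Bochner_Integration.integrable_bound)
    show "AE t in S. norm (t ^ k * \<psi> t) \<le> norm (A * \<bar>\<psi> t\<bar> + B * \<bar>\<psi> t * (\<Prod>j\<in>J. t - r j)\<bar>)"
    proof (rule AE_I2)
      fix t
      have "\<bar>t\<bar> ^ k * \<bar>\<psi> t\<bar> \<le> (A + B * \<bar>\<Prod>j\<in>J. t - r j\<bar>) * \<bar>\<psi> t\<bar>"
        by (intro mult_right_mono AB) auto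
      also have "\<dots> = A * \<bar>\<psi> t\<bar> + B * \<bar>\<psi> t * (\<Prod>j\<in>J. t - r j)\<bar>"
        by (simp add: algebra_simps abs_mult)
      also have "\<dots> \<le> \<bar>A * \<bar>\<psi> t\<bar> + B * \<bar>\<psi> t * (\<Prod>j\<in>J. t - r j)\<bar>\<bar>"
        by (rule abs_ge_self)
      finally show "norm (t ^ k * \<psi> t) \<le> norm (A * \<bar>\<psi> t\<bar> + B * \<bar>\<psi> t * (\<Prod>j\<in>J. t - r j)\<bar>)"
        by (simp only: real_norm_def abs_mult[of "t ^ k"] power_abs)
    qed
  qed measurable
qed

lemma sigma_finite_lebesgue_on_interval:
  fixes I :: "real set"
  assumes "is_interval I"
  shows "sigma_finite_measure (lebesgue_on I)"
proof (rule sigma_finite_measure_restrict_space)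
  obtain A where "countable A" "A \<subseteq> sets (lborel :: real measure)" "\<Union>A = space lborel"
      "\<forall>a\<in>A. emeasure lborel a \<noteq> \<infinity>"
    using lborel.sigma_finite_countable by blast
  then show "sigma_finite_measure (lebesgue :: real measure)"
    by (intro sigma_finite_measure.intro exI[of _ A]) (auto simp: subset_iff)
  show "I \<in> sets lebesgue"
    using real_interval_borel_measurable[OF assms] by auto
qed

text \<open>The cofactors of row \<open>i\<close> do not involve that row, so Laplace expansion
  along it isolates the dependence on \<open>t\<close>.\<close>

lemma det_fun_upd_row:
  fixes \<phi> :: "nat \<Rightarrow> real \<Rightarrow> real"
  assumes i: "i < N"
  shows "Determinant.det (Matrix.mat N N (\<lambda>(k, l). \<phi> l ((x(i := t)) k))) =
    (\<Sum>l<N. \<phi> l t * cofactor (Matrix.mat N N (\<lambda>(k, l). \<phi> l (x k))) i l)"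
proof -
  let ?A = "Matrix.mat N N (\<lambda>(k, l). \<phi> l ((x(i := t)) k))"
  have "mat_delete ?A i l = mat_delete (Matrix.mat N N (\<lambda>(k, l). \<phi> l (x k))) i l" if "l < N" for l
    unfolding mat_delete_def using i that by (intro eq_matI) auto
  then have "cofactor ?A i l = cofactor (Matrix.mat N N (\<lambda>(k, l). \<phi> l (x k))) i l" if "l < N" for l
    using that by (simp add: cofactor_def)
  then show ?thesis
    using i by (subst laplace_expansion_row[of _ N i]) auto
qed

text \<open>
  By Tonelli there is a point \<open>x\<close> of nonzero weight at which the weight is integrable in each
  coordinate separately. The determinant, as a function of the \<open>i\<close>-th coordinate, is then a combination
  \<open>\<psi> i\<close> of the \<open>\<phi> l\<close> whose product with a polynomial of degree \<open>N - 1\<close> is integrable, and since the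
  matrix at \<open>x\<close> is invertible, the \<open>\<phi> l\<close> are recovered from the \<open>\<psi> i\<close>.
\<close>

lemma ensemble_moment_integrable:
  assumes pe: "polynomial_ensemble I N \<phi>" and k: "k < N" and l: "l < N"
  shows "integrable (lebesgue_on I) (\<lambda>t. t ^ k * \<phi> l t)"
proof -
  define S where "S = lebesgue_on I"
  define w where "w = ensemble_weight N \<phi>"
  interpret product_sigma_finite "\<lambda>_::nat. S"
    using pe sigma_finite_lebesgue_on_interval by (intro product_sigma_finite.intro) (simp add: S_def polynomial_ensemble_def)
  have \<phi>: "integrable S (\<phi> l)" if "l < N" for l
    using pe that by (simp add: polynomial_ensemble_def S_def)
  have w: "integrable (PiM {..<N} (\<lambda>_. S)) w" and w0: "integral\<^sup>L (PiM {..<N} (\<lambda>_. S)) w \<noteq> 0"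
    using pe by (auto simp: polynomial_ensemble_def S_def lebesgue_pow_def ensemble_norm_def w_def)
  have w_meas [measurable]: "w \<in> borel_measurable (PiM {..<N} (\<lambda>_. S))" using w by simp
  have "AE x in PiM {..<N} (\<lambda>_. S). \<forall>i\<in>{..<N}. (\<integral>\<^sup>+ y. ennreal (norm (w (x(i := y)))) \<partial>S) \<noteq> \<infinity>"
    using w by (intro AE_finite_allI AE_nn_integral_fun_upd_finite)
      (auto simp: integrable_iff_bounded)
  \<comment> \<open>Otherwise the weight would vanish almost everywhere, contradicting the nonzero
    normalisation constant.\<close>
  then have "\<exists>x\<in>space (PiM {..<N} (\<lambda>_. S)). w x \<noteq> 0 \<and>
      (\<forall>i\<in>{..<N}. (\<integral>\<^sup>+ y. ennreal (norm (w (x(i := y)))) \<partial>S) \<noteq> \<infinity>)"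
  proof (rule contrapos_pp)
    assume *: "\<not> ?thesis"
    show "\<not> (AE x in PiM {..<N} (\<lambda>_. S). \<forall>i\<in>{..<N}. (\<integral>\<^sup>+ y. ennreal (norm (w (x(i := y)))) \<partial>S) \<noteq> \<infinity>)"
    proof
      assume "AE x in PiM {..<N} (\<lambda>_. S). \<forall>i\<in>{..<N}. (\<integral>\<^sup>+ y. ennreal (norm (w (x(i := y)))) \<partial>S) \<noteq> \<infinity>"
      then have "AE x in PiM {..<N} (\<lambda>_. S). w x = 0"
        using AE_space by eventually_elim (use * in blast)
      then show False using w0 by (simp add: integral_eq_zero_AE)
    qed
  qed
  then obtain x where x: "x \<in> space (PiM {..<N} (\<lambda>_. S))" and wx: "w x \<noteq> 0"
    and fin: "\<And>i. i < N \<Longrightarrow> (\<integral>\<^sup>+ y. ennreal (norm (w (x(i := y)))) \<partial>S) \<noteq> \<infinity>"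
    by blast
  define A where "A = Matrix.mat N N (\<lambda>(k, l). \<phi> l (x k))"
  define \<psi> where "\<psi> = (\<lambda>i t. \<Sum>l<N. \<phi> l t * cofactor A i l)"
  have detA: "Determinant.det A \<noteq> 0" and vand: "vandermonde_prod N x \<noteq> 0"
    using wx by (auto simp: w_def ensemble_weight_def A_def)
  have id: "(\<lambda>t. t) \<in> borel_measurable S"
    using id_borel_measurable_lebesgue_on unfolding S_def id_def .
  have \<psi>: "integrable S (\<lambda>t. t ^ k * \<psi> i t)" if i: "i < N" for i
  proof (rule integrable_power_mult[OF id])
    show int\<psi>: "integrable S (\<psi> i)"
      unfolding \<psi>_def using \<phi> by auto
    show "finite ({..<N} - {i})" "k \<le> card ({..<N} - {i})" using i k by auto
    have upd: "(\<lambda>t. x(i := t)) \<in> measurable S (PiM {..<N} (\<lambda>_. S))"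
      using i x by (intro measurable_fun_upd[where J = "{..<N}"]) auto
    have "(\<lambda>t. w (x(i := t))) \<in> borel_measurable S"
      by (rule measurable_compose[OF upd w_meas])
    then have int: "integrable S (\<lambda>t. w (x(i := t)))"
      using fin[OF i] by (simp add: integrable_iff_bounded top.not_eq_extremum)
    obtain K where K: "\<And>t. \<bar>vandermonde_prod N (x(i := t))\<bar> = K * \<bar>\<Prod>j\<in>{..<N}-{i}. t - x j\<bar>"
      using abs_vandermonde_prod_fun_upd[OF i] by blast
    \<comment> \<open>At \<open>t = x i\<close> the update does nothing, so \<open>K = 0\<close>
      would make the Vandermonde product vanish at \<open>x\<close>.\<close>
    have K0: "K \<noteq> 0" using K[of "x i"] vand by auto
    have "integrable S (\<lambda>t. w (x(i := t)) / K)" using int by auto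
    then show "integrable S (\<lambda>t. \<psi> i t * (\<Prod>j\<in>{..<N} - {i}. t - x j))"
    proof (rule Bochner_Integration.integrable_bound)
      show "(\<lambda>t. \<psi> i t * (\<Prod>j\<in>{..<N} - {i}. t - x j)) \<in> borel_measurable S"
        using int\<psi> id by measurable
      show "AE t in S. norm (\<psi> i t * (\<Prod>j\<in>{..<N} - {i}. t - x j)) \<le> norm (w (x(i := t)) / K)"
      proof (rule AE_I2)
        fix t
        have "w (x(i := t)) = vandermonde_prod N (x(i := t)) * \<psi> i t"
          unfolding w_def ensemble_weight_def det_fun_upd_row[OF i] \<psi>_def A_def ..
        then have "\<bar>w (x(i := t))\<bar> = K * \<bar>\<Prod>j\<in>{..<N}-{i}. t - x j\<bar> * \<bar>\<psi> i t\<bar>"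
          by (simp add: abs_mult K)
        then have "\<bar>w (x(i := t))\<bar> / \<bar>K\<bar> = (K / \<bar>K\<bar>) * (\<bar>\<psi> i t * (\<Prod>j\<in>{..<N} - {i}. t - x j)\<bar>)"
          by (simp add: abs_mult mult_ac)
        \<comment> \<open>The sign of \<open>K\<close> has not been recorded; if
          \<open>K < 0\<close>, nonnegativity forces both sides of the preceding equation to be
          zero.\<close>
        moreover have "\<bar>w (x(i := t))\<bar> / \<bar>K\<bar> \<ge> 0" by simp
        ultimately show "norm (\<psi> i t * (\<Prod>j\<in>{..<N} - {i}. t - x j)) \<le> norm (w (x(i := t)) / K)"
          using K0 by (cases "K > 0") auto
      qed
    qed
  qed
  \<comment> \<open>The \<open>\<psi> i\<close> arise from the \<open>\<phi> l\<close> through the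
    cofactors of \<open>A\<close>; the identity \<open>adj_mat A * A = Determinant.det A
    \<cdot>\<^sub>m 1\<^sub>m N\<close> inverts this relation.\<close>
  have cramer: "t ^ k * \<phi> l t = (\<Sum>i<N. \<phi> l (x i) / Determinant.det A * (t ^ k * \<psi> i t))" for t
  proof -
    have AN: "A \<in> carrier_mat N N" by (simp add: A_def)
    have cof: "(\<Sum>i<N. cofactor A i m * \<phi> l (x i)) = (if m = l then Determinant.det A else 0)"
      if m: "m < N" for m
    proof -
      have "(adj_mat A * A) $$ (m, l) = (Determinant.det A \<cdot>\<^sub>m 1\<^sub>m N) $$ (m, l)"
        using adj_mat(3)[OF AN] by simp
      moreover have "(adj_mat A * A) $$ (m, l) = (\<Sum>i<N. cofactor A i m * \<phi> l (x i))"
        using m l by (simp add: adj_mat_def scalar_prod_def A_def atLeast0LessThan)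
      ultimately show ?thesis using m l by simp
    qed
    have "(\<Sum>i<N. \<phi> l (x i) * \<psi> i t) = (\<Sum>m<N. \<phi> m t * (\<Sum>i<N. cofactor A i m * \<phi> l (x i)))"
      unfolding \<psi>_def sum_distrib_left by (subst sum.swap) (simp only: mult_ac)
    also have "\<dots> = (\<Sum>m<N. if m = l then \<phi> l t * Determinant.det A else 0)"
      by (intro sum.cong refl) (simp add: cof)
    also have "\<dots> = \<phi> l t * Determinant.det A" using l by simp
    finally have "\<phi> l t = (\<Sum>i<N. \<phi> l (x i) * \<psi> i t) / Determinant.det A"
      using detA by simp
    then have "t ^ k * \<phi> l t = t ^ k * ((\<Sum>i<N. \<phi> l (x i) * \<psi> i t) / Determinant.det A)" by simp
    then show ?thesis
      by (simp add: sum_distrib_left sum_divide_distrib mult_ac)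
  qed
  show ?thesis
    unfolding cramer S_def[symmetric] using \<psi> by auto
qed

section \<open>Expectations of ratios\<close>

lemma integrable_bounded_mult:
  fixes f g :: "'a \<Rightarrow> complex"
  assumes "integrable S g" and f: "f \<in> borel_measurable S" and B: "\<And>t. norm (f t) \<le> B"
  shows "integrable S (\<lambda>t. f t * g t)"
proof -
  have "integrable S (\<lambda>t. complex_of_real B * g t)" using assms by auto
  then show ?thesis
  proof (rule Bochner_Integration.integrable_bound)
    show "(\<lambda>t. f t * g t) \<in> borel_measurable S" using assms by simp
    have "norm (f t * g t) \<le> norm (complex_of_real B * g t)" for t
      using B[of t] by (simp add: norm_mult mult_right_mono)
    then show "AE t in S. norm (f t * g t) \<le> norm (complex_of_real B * g t)" by simp
  qed
qed

text \<open>For \<open>f\<close> constantly \<open>1\<close> this is the generalised moment matrix,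
  with the power \<open>t ^ k\<close> in row \<open>k\<close> since indices start at
  \<open>0\<close>. A general \<open>f\<close> gives the matrix that takes its place when the weight
  is multiplied by \<open>\<Prod>n<N. f (x n)\<close>.\<close>

definition moment_mat ::
    "real set \<Rightarrow> nat \<Rightarrow> (nat \<Rightarrow> real \<Rightarrow> real) \<Rightarrow> (real \<Rightarrow> complex) \<Rightarrow> complex mat" where
  "moment_mat I N \<phi> f =
     Matrix.mat N N (\<lambda>(k, l). \<integral>t. complex_of_real t ^ k * f t * complex_of_real (\<phi> l t) \<partial>lebesgue_on I)"

context
  fixes I :: "real set" and N :: nat and \<phi> :: "nat \<Rightarrow> real \<Rightarrow> real"
  assumes pe: "polynomial_ensemble I N \<phi>"
begin

lemma ensemble_moment_integrable_mult:
  assumes f: "f \<in> borel_measurable (lebesgue_on I)" and B: "\<And>t. norm (f t) \<le> B"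
    and "k < N" "l < N"
  shows "integrable (lebesgue_on I) (\<lambda>t. complex_of_real t ^ k * f t * complex_of_real (\<phi> l t))"
proof -
  have "integrable (lebesgue_on I) (\<lambda>t. complex_of_real (t ^ k * \<phi> l t))"
    using ensemble_moment_integrable[OF pe assms(3,4)] by (rule integrable_of_real)
  from integrable_bounded_mult[OF this f B] show ?thesis
    by (simp add: mult_ac)
qed

text \<open>The factors \<open>f (x n)\<close> are absorbed into the rows of the Vandermonde matrix,
  and Andreief's identity applies to \<open>t ^ k * f t\<close> and \<open>\<phi> l\<close>. The
  sign comes from the order of the differences in \<open>vandermonde_prod\<close>.\<close>

lemma weight_integral:
  assumes f: "f \<in> borel_measurable (lebesgue_on I)" and B: "\<And>t. norm (f t) \<le> B"
  shows "(\<integral>x. complex_of_real (ensemble_weight N \<phi> x) * (\<Prod>n<N. f (x n)) \<partial>lebesgue_pow I N) =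
    (\<Prod>j<N. (-1) ^ j) * fact N * Determinant.det (moment_mat I N \<phi> f)"
proof -
  have sg: "(\<Prod>j<N. (-1) ^ j) * (\<Prod>j<N. (-1) ^ j) = (1 :: complex)"
    by (simp flip: power_mult_distrib prod.distrib)
  have V: "complex_of_real (vandermonde_prod N x) =
      (\<Prod>j<N. (-1) ^ j) * Determinant.det (Matrix.mat N N (\<lambda>(k, l). complex_of_real (x k) ^ l))" for x
    unfolding vandermonde_prod_eq_det[symmetric] using sg by (simp add: mult.left_commute)
  have D: "complex_of_real (Determinant.det (Matrix.mat N N (\<lambda>(k, l). \<phi> l (x k)))) =
      Determinant.det (Matrix.mat N N (\<lambda>(k, l). complex_of_real (\<phi> l (x k))))" for x
    by (simp add: det_mat_leibniz)
  have "complex_of_real (ensemble_weight N \<phi> x) * (\<Prod>n<N. f (x n)) =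
      (\<Prod>j<N. (-1) ^ j) *
      (Determinant.det (Matrix.mat N N (\<lambda>(k, l). complex_of_real (x k) ^ l * f (x k))) *
       Determinant.det (Matrix.mat N N (\<lambda>(k, l). complex_of_real (\<phi> l (x k)))))" for x
    using det_mat_scale_rows[of N "\<lambda>k. f (x k)" "\<lambda>k l. complex_of_real (x k) ^ l"]
    by (simp add: ensemble_weight_def V D mult_ac)
  moreover have "sigma_finite_measure (lebesgue_on I)"
    using pe sigma_finite_lebesgue_on_interval by (simp add: polynomial_ensemble_def)
  ultimately show ?thesis
    using andreief_identity[of "lebesgue_on I" N "\<lambda>l t. complex_of_real t ^ l * f t" "\<lambda>l t. complex_of_real (\<phi> l t)"]
      ensemble_moment_integrable_mult[OF f B]
    by (simp add: lebesgue_pow_def moment_mat_def mult.assoc)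
qed

text \<open>Taking \<open>f\<close> constantly \<open>1\<close> evaluates the normalisation constant
  as \<open>?s\<close> times the moment determinant, which is therefore nonzero. In the expectation
  the common factor \<open>?s\<close> cancels.\<close>

lemma moment_mat_det_nonzero: "Determinant.det (moment_mat I N \<phi> (\<lambda>_. 1)) \<noteq> 0"
  and ensemble_expectation_prod:
    "f \<in> borel_measurable (lebesgue_on I) \<Longrightarrow> (\<And>t. norm (f t) \<le> B) \<Longrightarrow>
      ensemble_expectation I N \<phi> (\<lambda>x. \<Prod>n<N. f (x n)) =
      Determinant.det (moment_mat I N \<phi> f) / Determinant.det (moment_mat I N \<phi> (\<lambda>_. 1))"
proof -
  let ?s = "(\<Prod>j<N. (-1) ^ j) * fact N :: complex"
  have norm0: "ensemble_norm I N \<phi> \<noteq> 0" and w: "integrable (lebesgue_pow I N) (ensemble_weight N \<phi>)"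
    and pos: "AE x in lebesgue_pow I N. 0 \<le> ensemble_density I N \<phi> x"
    using pe by (auto simp: polynomial_ensemble_def)
  have norm: "complex_of_real (ensemble_norm I N \<phi>) = ?s * Determinant.det (moment_mat I N \<phi> (\<lambda>_. 1))"
    using weight_integral[of "\<lambda>_. 1" 1] by (simp add: ensemble_norm_def)
  then show nz: "Determinant.det (moment_mat I N \<phi> (\<lambda>_. 1)) \<noteq> 0" using norm0 by auto
  have s0: "?s \<noteq> 0" by simp
  assume f: "f \<in> borel_measurable (lebesgue_on I)" and B: "\<And>t. norm (f t) \<le> B"
  have meas: "(\<lambda>x. \<Prod>n<N. f (x n)) \<in> borel_measurable (lebesgue_pow I N)"
    unfolding lebesgue_pow_def
    by (intro borel_measurable_prod measurable_compose[OF _ f] measurable_component_singleton) auto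
  have d: "ensemble_density I N \<phi> \<in> borel_measurable (lebesgue_pow I N)"
    unfolding ensemble_density_def using w by simp
  have "ensemble_expectation I N \<phi> (\<lambda>x. \<Prod>n<N. f (x n)) =
      (\<integral>x. ensemble_density I N \<phi> x *\<^sub>R (\<Prod>n<N. f (x n)) \<partial>lebesgue_pow I N)"
    unfolding ensemble_expectation_def ensemble_measure_def
    by (rule integral_density[OF meas d pos])
  also have "\<dots> = (\<integral>x. 1 / complex_of_real (ensemble_norm I N \<phi>) *
      (complex_of_real (ensemble_weight N \<phi> x) * (\<Prod>n<N. f (x n))) \<partial>lebesgue_pow I N)"
    by (simp add: ensemble_density_def scaleR_conv_of_real)
  also have "\<dots> = 1 / complex_of_real (ensemble_norm I N \<phi>) * (?s * Determinant.det (moment_mat I N \<phi> f))"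
    by (simp only: integral_mult_right_zero weight_integral[OF f B])
  also have "\<dots> = Determinant.det (moment_mat I N \<phi> f) / Determinant.det (moment_mat I N \<phi> (\<lambda>_. 1))"
    unfolding norm using s0 nz by (simp del: prod_constant)
  finally show "ensemble_expectation I N \<phi> (\<lambda>x. \<Prod>n<N. f (x n)) =
      Determinant.det (moment_mat I N \<phi> f) / Determinant.det (moment_mat I N \<phi> (\<lambda>_. 1))" .
qed

end

section \<open>Boundedness and partial fractions of the ratios\<close>

lemma norm_diff_of_real_ge:
  assumes "u \<notin> \<real>"
  shows "\<bar>Im u\<bar> \<le> norm (u - complex_of_real t)" "0 < \<bar>Im u\<bar>" "u \<noteq> complex_of_real t"
  using abs_Im_le_cmod[of "u - complex_of_real t"] assms by (auto simp: complex_is_Real_iff)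

text \<open>Each factor is \<open>1 + (z m - u m) / (u m - t)\<close>, whose denominator is at least
  \<open>\<bar>Im (u m)\<bar>\<close> in norm. A bound uniform in \<open>t\<close> reduces
  integrability to that of the moments.\<close>

lemma norm_prod_ratio_le:
  fixes u z :: "nat \<Rightarrow> complex"
  assumes u: "\<And>m. m < M \<Longrightarrow> u m \<notin> \<real>"
  shows "norm (\<Prod>m<M. (z m - complex_of_real t) / (u m - complex_of_real t)) \<le>
    (\<Prod>m<M. 1 + norm (z m - u m) / \<bar>Im (u m)\<bar>)"
  unfolding prod_norm[symmetric]
proof (intro prod_mono conjI)
  fix m assume "m \<in> {..<M}"
  then have m: "u m \<notin> \<real>" using u by auto
  note * = norm_diff_of_real_ge(1)[OF m, of t] norm_diff_of_real_ge(2)[OF m] norm_diff_of_real_ge(3)[OF m, of t]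
  have "(z m - complex_of_real t) / (u m - complex_of_real t) = 1 + (z m - u m) / (u m - complex_of_real t)"
    using *(3) by (simp add: field_simps)
  then have "norm ((z m - complex_of_real t) / (u m - complex_of_real t)) \<le>
      1 + norm (z m - u m) / norm (u m - complex_of_real t)"
    by (metis norm_divide norm_one norm_triangle_ineq)
  also have "\<dots> \<le> 1 + norm (z m - u m) / \<bar>Im (u m)\<bar>"
    using * by (intro add_left_mono divide_left_mono mult_pos_pos) auto
  finally show "norm ((z m - complex_of_real t) / (u m - complex_of_real t)) \<le>
      1 + norm (z m - u m) / \<bar>Im (u m)\<bar>" .
qed auto

text \<open>Numerator and denominator of the ratio both have degree \<open>M\<close> and leading
  coefficient \<open>(-1) ^ M\<close>, so the polynomial part is monic of degree \<open>k\<close>.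
  Over all \<open>k < N\<close> the coefficients \<open>a\<close> thus form a lower unitriangular
  matrix.\<close>

lemma unitriangular_partial_fractions:
  fixes u z :: "nat \<Rightarrow> complex"
  assumes u: "inj_on u {..<M}" and k: "k < N"
  obtains a c where "a k = 1" "\<And>l. k < l \<Longrightarrow> a l = 0"
    "\<And>x. (\<And>m. m < M \<Longrightarrow> x \<noteq> u m) \<Longrightarrow>
      x ^ k * (\<Prod>m<M. (z m - x) / (u m - x)) = (\<Sum>l<N. a l * x ^ l) + (\<Sum>m<M. c m / (u m - x))"
proof -
  define q where "q = (\<Prod>m<M. [:u m, -1:])"
  define p where "p = Polynomial.monom 1 k * (\<Prod>m<M. [:z m, -1:])"
  obtain c where c: "\<And>x. (\<And>m. m < M \<Longrightarrow> x \<noteq> u m) \<Longrightarrow>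
      poly p x / (\<Prod>m<M. u m - x) = poly (p div q) x + (\<Sum>m<M. c m / (u m - x))"
    using partial_fractions[OF u, where p = p] unfolding q_def by blast
  have q0: "q \<noteq> 0" unfolding q_def by (subst prod_zero_iff) auto
  have degq: "degree q = M"
    unfolding q_def by (subst degree_prod_eq_sum_degree) auto
  have lcq: "lead_coeff q = (-1) ^ M"
    unfolding q_def lead_coeff_prod by simp
  have z0: "(\<Prod>m<M. [:z m, -1:]) \<noteq> 0" by (subst prod_zero_iff) auto
  have "degree (\<Prod>m<M. [:z m, -1:]) = M"
    by (subst degree_prod_eq_sum_degree) auto
  then have degp: "degree p = k + M"
    unfolding p_def using z0 by (subst degree_mult_eq) (auto simp: degree_monom_eq)
  have lcp: "lead_coeff p = (-1) ^ M"
    unfolding p_def lead_coeff_mult lead_coeff_prod by (simp add: degree_monom_eq)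
  define s where "s = p div q"
  \<comment> \<open>Since the remainder has no coefficient of index \<open>M\<close> or above,
    \<open>s * q\<close> and \<open>p\<close> agree at the top index \<open>k + M\<close>.\<close>
  have r: "poly.coeff (p mod q) i = 0" if "M \<le> i" for i
    using degree_mod_less[OF q0, of p] that degq by (auto intro: coeff_eq_0)
  have sq: "s * q = p - p mod q"
    unfolding s_def by (simp add: minus_mod_eq_div_mult)
  have lc: "poly.coeff (s * q) (k + M) = (-1) ^ M"
    using lcp degp r by (simp add: sq)
  have deg_sq: "degree (s * q) = k + M"
  proof (rule antisym)
    show "degree (s * q) \<le> k + M"
      by (rule degree_le) (simp add: sq r coeff_eq_0 degp)
    show "k + M \<le> degree (s * q)" using lc by (intro le_degree) simp
  qed
  have s0: "s \<noteq> 0" using lc by auto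
  have degs: "degree s = k"
    using deg_sq degree_mult_eq[OF s0 q0] degq by simp
  have lcs: "lead_coeff s = 1"
    using lc lead_coeff_mult[of s q] lcq by (simp add: deg_sq)
  show thesis
  proof (rule that[of "poly.coeff s" c])
    show "poly.coeff s k = 1" using lcs degs by simp
    show "poly.coeff s l = 0" if "k < l" for l using that degs by (simp add: coeff_eq_0)
    fix x assume x: "\<And>m. m < M \<Longrightarrow> x \<noteq> u m"
    have "x ^ k * (\<Prod>m<M. (z m - x) / (u m - x)) = poly p x / (\<Prod>m<M. u m - x)"
      by (simp add: p_def poly_monom poly_prod prod_dividef)
    also have "\<dots> = poly s x + (\<Sum>m<M. c m / (u m - x))"
      unfolding s_def by (rule c[OF x])
    also have "poly s x = (\<Sum>l\<le>k. poly.coeff s l * x ^ l)"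
      by (simp add: poly_altdef degs)
    also have "\<dots> = (\<Sum>l<N. poly.coeff s l * x ^ l)"
      using k by (intro sum.mono_neutral_left) (auto intro!: coeff_eq_0 simp: degs)
    finally show "x ^ k * (\<Prod>m<M. (z m - x) / (u m - x)) =
        (\<Sum>l<N. poly.coeff s l * x ^ l) + (\<Sum>m<M. c m / (u m - x))" .
  qed
qed

text \<open>
  The entry at \<open>(u, z)\<close> of the Schur complement; \<open>Gi\<close> stands for the inverse of the moment matrix.
\<close>

definition resolvent_kernel ::
    "real set \<Rightarrow> nat \<Rightarrow> (nat \<Rightarrow> real \<Rightarrow> real) \<Rightarrow> complex mat \<Rightarrow> complex \<Rightarrow> complex \<Rightarrow> complex" where
  "resolvent_kernel I N \<phi> Gi u z = 1 / (u - z) -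
     (\<Sum>l<N. (\<integral>t. 1 / (u - complex_of_real t) * complex_of_real (\<phi> l t) \<partial>lebesgue_on I) *
        (\<Sum>k<N. Gi $$ (l, k) * z ^ k))"

text \<open>The partial fraction coefficients of \<open>x ^ k\<close> times the ratio supply the
  matrices \<open>T\<close> and \<open>C\<close> of \<open>det_schur_exchange\<close>. The result
  serves twice: for the given families, and for \<open>M = 1\<close> to identify the kernel.\<close>

lemma expectation_ratio_times_cauchy_det:
  fixes u z :: "nat \<Rightarrow> complex"
  assumes pe: "polynomial_ensemble I N \<phi>"
    and Gi: "Gi \<in> carrier_mat N N" "moment_mat I N \<phi> (\<lambda>_. 1) * Gi = 1\<^sub>m N"
    and u: "\<And>m. m < M \<Longrightarrow> u m \<notin> \<real>" and inj: "inj_on u {..<M}"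
    and uz: "\<And>i j. i < M \<Longrightarrow> j < M \<Longrightarrow> u i \<noteq> z j"
  shows "ensemble_expectation I N \<phi> (\<lambda>x. \<Prod>m<M. D_poly N (z m) x / D_poly N (u m) x) *
      Determinant.det (Matrix.mat M M (\<lambda>(i, j). 1 / (u i - z j))) =
    Determinant.det (Matrix.mat M M (\<lambda>(i, j). resolvent_kernel I N \<phi> Gi (u i) (z j)))"
proof -
  define S where "S = lebesgue_on I"
  define f where "f = (\<lambda>t. \<Prod>m<M. (z m - complex_of_real t) / (u m - complex_of_real t))"
  define G where "G = moment_mat I N \<phi> (\<lambda>_. 1)"
  define X where "X = Matrix.mat N M (\<lambda>(k, j). z j ^ k)"
  define h where "h = (\<lambda>i l. \<integral>t. 1 / (u i - complex_of_real t) * complex_of_real (\<phi> l t) \<partial>S)"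
  define H where "H = Matrix.mat M N (\<lambda>(i, l). h i l)"
  define W where "W = Matrix.mat M M (\<lambda>(i, j). 1 / (u i - z j))"
  have ut: "u m \<noteq> complex_of_real t" if "m < M" for m t
    using norm_diff_of_real_ge(3)[OF u[OF that]] .
  have id [measurable]: "(\<lambda>t. t) \<in> borel_measurable S"
    using id_borel_measurable_lebesgue_on unfolding S_def id_def .
  have f: "f \<in> borel_measurable (lebesgue_on I)"
    unfolding f_def S_def[symmetric] by measurable
  have f': "norm (f t) \<le> (\<Prod>m<M. 1 + norm (z m - u m) / \<bar>Im (u m)\<bar>)" for t
    unfolding f_def by (rule norm_prod_ratio_le[OF u])
  \<comment> \<open>\<open>Q\<close> bundles the conditions on the coefficients for one
    \<open>k\<close>, so that they can be chosen for all \<open>k < N\<close> at once.\<close>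
  define Q where "Q = (\<lambda>k (a :: nat \<Rightarrow> complex) (c :: nat \<Rightarrow> complex). a k = 1 \<and> (\<forall>l>k. a l = 0) \<and>
    (\<forall>x. (\<forall>m<M. x \<noteq> u m) \<longrightarrow>
      x ^ k * (\<Prod>m<M. (z m - x) / (u m - x)) = (\<Sum>l<N. a l * x ^ l) + (\<Sum>m<M. c m / (u m - x))))"
  have "\<exists>a c. Q k a c" if "k < N" for k
    by (rule unitriangular_partial_fractions[OF inj that, of z]) (unfold Q_def, blast)
  then obtain a c where Q: "\<And>k. k < N \<Longrightarrow> Q k (a k) (c k)"
    by metis
  have a1: "a k k = 1" if "k < N" for k
    using Q[OF that] by (simp add: Q_def)
  have a0: "a k l = 0" if "k < N" "k < l" for k l
    using Q[OF that(1)] that(2) by (simp add: Q_def)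
  have pf: "x ^ k * (\<Prod>m<M. (z m - x) / (u m - x)) = (\<Sum>l<N. a k l * x ^ l) + (\<Sum>m<M. c k m / (u m - x))"
    if "k < N" "\<And>m. m < M \<Longrightarrow> x \<noteq> u m" for k x
    using Q[OF that(1)] that(2) by (simp add: Q_def)
  define T where "T = Matrix.mat N N (\<lambda>(k, l). a k l)"
  define C where "C = Matrix.mat N M (\<lambda>(k, m). c k m)"
  have "Determinant.det T = prod_list (diag_mat T)"
    by (rule det_lower_triangular[of N]) (auto simp: T_def a0)
  also have "\<dots> = 1" by (auto simp: prod_list_diag_prod T_def a1)
  finally have detT: "Determinant.det T = 1" .
  \<comment> \<open>Each \<open>z j\<close> is a zero of the ratio and, by \<open>uz\<close>, none
    of its poles, so the expansion evaluates to zero there.\<close>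
  have TX: "T * X + C * W = 0\<^sub>m N M"
  proof (rule eq_matI)
    fix k j assume "k < dim_row (0\<^sub>m N M)" "j < dim_col (0\<^sub>m N M)"
    then have kj: "k < N" "j < M" by auto
    have "(T * X + C * W) $$ (k, j) = (\<Sum>l<N. a k l * z j ^ l) + (\<Sum>m<M. c k m / (u m - z j))"
      using kj by (simp add: T_def X_def C_def W_def scalar_prod_def atLeast0LessThan)
    also have "\<dots> = z j ^ k * (\<Prod>m<M. (z m - z j) / (u m - z j))"
      using uz[OF _ kj(2)] by (intro pf[OF kj(1), symmetric]) force
    also have "(\<Prod>m<M. (z m - z j) / (u m - z j)) = 0"
      using kj by (intro prod_zero) auto
    finally show "(T * X + C * W) $$ (k, j) = 0\<^sub>m N M $$ (k, j)" using kj by simp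
  qed (auto simp: T_def C_def X_def W_def)
  \<comment> \<open>The same expansion at real \<open>t\<close>, integrated against
    \<open>\<phi> l\<close>: the powers give \<open>T * G\<close> and the resolvents give
    \<open>C * H\<close>.\<close>
  have TG: "T * G + C * H = moment_mat I N \<phi> f"
  proof (rule eq_matI)
    fix k l assume "k < dim_row (moment_mat I N \<phi> f)" "l < dim_col (moment_mat I N \<phi> f)"
    then have kl: "k < N" "l < N" by (auto simp: moment_mat_def)
    have i1: "integrable S (\<lambda>t. a k i * (complex_of_real t ^ i * complex_of_real (\<phi> l t)))" if "i < N" for i
      using ensemble_moment_integrable_mult[OF pe, of "\<lambda>_. 1" 1 i l] kl that by (simp add: S_def)
    have i2: "integrable S (\<lambda>t. c k m * (1 / (u m - complex_of_real t) * complex_of_real (\<phi> l t)))"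
      if m: "m < M" for m
    proof (intro integrable_mult_right integrable_bounded_mult)
      show "integrable S (\<lambda>t. complex_of_real (\<phi> l t))"
        using pe kl by (intro integrable_of_real) (simp add: polynomial_ensemble_def S_def)
      show "norm (1 / (u m - complex_of_real t)) \<le> 1 / \<bar>Im (u m)\<bar>" for t
        using norm_diff_of_real_ge(1)[OF u[OF m], of t] norm_diff_of_real_ge(2)[OF u[OF m]] unfolding norm_divide norm_one
        by (intro divide_left_mono mult_pos_pos) auto
    qed measurable
    have "moment_mat I N \<phi> f $$ (k, l) = (\<integral>t. complex_of_real t ^ k * f t * complex_of_real (\<phi> l t) \<partial>S)"
      using kl by (simp add: moment_mat_def S_def)
    also have "\<dots> = (\<integral>t. (\<Sum>i<N. a k i * (complex_of_real t ^ i * complex_of_real (\<phi> l t))) +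
        (\<Sum>m<M. c k m * (1 / (u m - complex_of_real t) * complex_of_real (\<phi> l t))) \<partial>S)"
    proof (intro Bochner_Integration.integral_cong refl)
      fix t
      have eq: "complex_of_real t ^ k * f t = (\<Sum>i<N. a k i * complex_of_real t ^ i) +
          (\<Sum>m<M. c k m / (u m - complex_of_real t))"
        unfolding f_def by (intro pf[OF kl(1)] ut[symmetric])
      show "complex_of_real t ^ k * f t * complex_of_real (\<phi> l t) =
        (\<Sum>i<N. a k i * (complex_of_real t ^ i * complex_of_real (\<phi> l t))) +
        (\<Sum>m<M. c k m * (1 / (u m - complex_of_real t) * complex_of_real (\<phi> l t)))"
        unfolding eq distrib_right sum_distrib_right by (simp add: mult_ac)
    qed
    also have "\<dots> = (\<integral>t. (\<Sum>i<N. a k i * (complex_of_real t ^ i * complex_of_real (\<phi> l t))) \<partial>S) +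
        (\<integral>t. (\<Sum>m<M. c k m * (1 / (u m - complex_of_real t) * complex_of_real (\<phi> l t))) \<partial>S)"
      using i1 i2 by (intro Bochner_Integration.integral_add Bochner_Integration.integrable_sum) auto
    also have "(\<integral>t. (\<Sum>i<N. a k i * (complex_of_real t ^ i * complex_of_real (\<phi> l t))) \<partial>S) =
        (\<Sum>i<N. a k i * (\<integral>t. complex_of_real t ^ i * complex_of_real (\<phi> l t) \<partial>S))"
      using i1 by (subst Bochner_Integration.integral_sum) auto
    also have "(\<integral>t. (\<Sum>m<M. c k m * (1 / (u m - complex_of_real t) * complex_of_real (\<phi> l t))) \<partial>S) =
        (\<Sum>m<M. c k m * h m l)"
      unfolding h_def using i2
      by (subst Bochner_Integration.integral_sum) (auto simp only: integral_mult_right_zero lessThan_iff)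
    also have "(\<Sum>i<N. a k i * (\<integral>t. complex_of_real t ^ i * complex_of_real (\<phi> l t) \<partial>S)) +
        (\<Sum>m<M. c k m * h m l) = (T * G + C * H) $$ (k, l)"
      using kl by (simp add: T_def G_def C_def H_def moment_mat_def scalar_prod_def atLeast0LessThan S_def)
    finally show "(T * G + C * H) $$ (k, l) = moment_mat I N \<phi> f $$ (k, l)" by simp
  qed (auto simp: T_def C_def G_def H_def moment_mat_def)
  have "Determinant.det (moment_mat I N \<phi> f) * Determinant.det W =
      Determinant.det G * Determinant.det (W - H * (Gi * X))"
    unfolding TG[symmetric] using Gi(1) Gi(2)[folded G_def] TX detT
    by (intro det_schur_exchange[where n = N and m = M])
       (auto simp: T_def C_def G_def H_def X_def W_def moment_mat_def)
  moreover have "W - H * (Gi * X) = Matrix.mat M M (\<lambda>(i, j). resolvent_kernel I N \<phi> Gi (u i) (z j))"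
    using Gi(1) by (intro eq_matI)
      (auto simp: W_def H_def X_def h_def S_def resolvent_kernel_def scalar_prod_def atLeast0LessThan)
  moreover have "(\<Prod>m<M. D_poly N (z m) x / D_poly N (u m) x) = (\<Prod>n<N. f (x n))" for x
    unfolding D_poly_def f_def prod_dividef[symmetric] by (rule prod.swap)
  ultimately show ?thesis
    using ensemble_expectation_prod[OF pe f f'] moment_mat_det_nonzero[OF pe]
    by (simp add: W_def G_def)
qed

theorem theorem2p3:
  fixes I :: "real set" and N M :: nat
    and \<phi> :: "nat \<Rightarrow> real \<Rightarrow> real"
    and u z :: "nat \<Rightarrow> complex"
  assumes "polynomial_ensemble I N \<phi>"
    and "\<And>i. i < M \<Longrightarrow> u i \<notin> \<real>"
    and "inj_on u {..<M}"
    and "inj_on z {..<M}"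
    and "\<And>i j. i < M \<Longrightarrow> j < M \<Longrightarrow> u i \<noteq> z j"
  shows "ensemble_expectation I N \<phi> (\<lambda>x. \<Prod>m<M. D_poly N (z m) x / D_poly N (u m) x) =
    inverse (Determinant.det (Matrix.mat M M (\<lambda>(i, j). 1 / (u i - z j)))) *
    Determinant.det (Matrix.mat M M (\<lambda>(i, j).
      1 / (u i - z j) *
      ensemble_expectation I N \<phi> (\<lambda>x. D_poly N (z j) x / D_poly N (u i) x)))"
proof -
  let ?G = "moment_mat I N \<phi> (\<lambda>_. 1)"
  have G: "?G \<in> carrier_mat N N" by (simp add: moment_mat_def)
  have "?G * adj_mat ?G = Determinant.det ?G \<cdot>\<^sub>m 1\<^sub>m N" and adj: "adj_mat ?G \<in> carrier_mat N N"
    using adj_mat[OF G] by auto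
  then have "?G * (inverse (Determinant.det ?G) \<cdot>\<^sub>m adj_mat ?G) = 1\<^sub>m N"
    using moment_mat_det_nonzero[OF assms(1)] mult_smult_distrib[OF G adj]
    by (intro eq_matI) auto
  then obtain Gi where Gi: "Gi \<in> carrier_mat N N" "?G * Gi = 1\<^sub>m N"
    using adj by (meson smult_carrier_mat)
  \<comment> \<open>With constant families and \<open>M = 1\<close> both determinants are single
    entries, which expresses the kernel, for the same \<open>Gi\<close>, by the expectation of one
    ratio.\<close>
  have kernel: "resolvent_kernel I N \<phi> Gi (u i) (z j) = 1 / (u i - z j) *
      ensemble_expectation I N \<phi> (\<lambda>x. D_poly N (z j) x / D_poly N (u i) x)" if "i < M" "j < M" for i j
    using expectation_ratio_times_cauchy_det[OF assms(1) Gi, of 1 "\<lambda>_. u i" "\<lambda>_. z j"] assms(2)[OF that(1)] assms(5)[OF that]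
    by (simp add: det_single inj_on_def)
  have "ensemble_expectation I N \<phi> (\<lambda>x. \<Prod>m<M. D_poly N (z m) x / D_poly N (u m) x) *
      Determinant.det (Matrix.mat M M (\<lambda>(i, j). 1 / (u i - z j))) =
    Determinant.det (Matrix.mat M M (\<lambda>(i, j). resolvent_kernel I N \<phi> Gi (u i) (z j)))"
    by (rule expectation_ratio_times_cauchy_det[OF assms(1) Gi assms(2,3,5)])
  also have "Matrix.mat M M (\<lambda>(i, j). resolvent_kernel I N \<phi> Gi (u i) (z j)) =
      Matrix.mat M M (\<lambda>(i, j). 1 / (u i - z j) *
        ensemble_expectation I N \<phi> (\<lambda>x. D_poly N (z j) x / D_poly N (u i) x))"
    by (intro eq_matI) (auto simp: kernel)
  finally show ?thesis
    using cauchy_matrix_det_nonzero[OF assms(3-5)] by (simp add: field_simps)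
qed

end
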